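(* Let $D$ be a thick convex subset of a real linear space. Suppose that for every approximately affine function $f:D\to\mathbb{R}$ there is an affine function $a:D\to\mathbb{R}$ with $\sup_{x\in D}|f(x)-a(x)|<\infty$. Then there is a constant $A_D$ such that for every $\varepsilon$ and every $\varepsilon$-affine function $f:D\to\mathbb{R}$ there is an affine function $a:D\to\mathbb{R}$ with $\sup_{x\in D}|f(x)-a(x)|\le A_D\cdot\varepsilon$.
   Context: Let $D$ be a convex subset of a real linear space (no topology is assumed). A point $d\in D$ is geometrically interior to $D$ if for every $v$ in the linear space spanned by $D$ one has $d\pm tv\in D$ for all sufficiently small $t>0$. The convex set $D$ is thick if it has at least one geometrically interior point. A function $f:D\to\mathbb{R}$ is $\varepsilon$-affine if $|f(tx+(1-t)y)-tf(x)-(1-t)f(y)|\le\varepsilon$ for all $x,y\in D$, $t\in[0,1]$; it is approximately affine if it is $\varepsilon$-affine for some $\varepsilon$, and affine if it is $0$-affine. *)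

theory Defs
  imports "HOL-Analysis.Analysis"
begin

text \<open>
  The span is the linear span, not the affine hull: a convex set contained in an affine
  hyperplane that misses the origin has no geometrically interior point.
\<close>

definition geometrically_interior :: "'a::real_vector \<Rightarrow> 'a set \<Rightarrow> bool" where
  "geometrically_interior d D \<longleftrightarrow>
     d \<in> D \<and> (\<forall>v\<in>span D. \<exists>\<delta>>0. \<forall>t::real. 0 < t \<and> t < \<delta> \<longrightarrow>
        d + t *\<^sub>R v \<in> D \<and> d - t *\<^sub>R v \<in> D)"

definition thick :: "'a::real_vector set \<Rightarrow> bool" where
  "thick D \<longleftrightarrow> convex D \<and> (\<exists>d. geometrically_interior d D)"

text \<open>
  Functions \<open>D \<rightarrow> \<real>\<close> are represented by total functions, of which only the
  values on \<open>D\<close> matter.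
\<close>

definition eps_affine_on :: "real \<Rightarrow> 'a::real_vector set \<Rightarrow> ('a \<Rightarrow> real) \<Rightarrow> bool" where
  "eps_affine_on \<epsilon> D f \<longleftrightarrow>
     (\<forall>x\<in>D. \<forall>y\<in>D. \<forall>t\<in>{0..1}.
        \<bar>f (t *\<^sub>R x + (1 - t) *\<^sub>R y) - t * f x - (1 - t) * f y\<bar> \<le> \<epsilon>)"

definition approximately_affine_on :: "'a::real_vector set \<Rightarrow> ('a \<Rightarrow> real) \<Rightarrow> bool" where
  "approximately_affine_on D f \<longleftrightarrow> (\<exists>\<epsilon>. eps_affine_on \<epsilon> D f)"

definition affine_fun_on :: "'a::real_vector set \<Rightarrow> ('a \<Rightarrow> real) \<Rightarrow> bool" where
  "affine_fun_on D f \<longleftrightarrow> eps_affine_on 0 D f"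

text \<open>The supremum is taken in the extended reals, so that it is meaningful without boundedness.\<close>

definition sup_dist_on :: "'a set \<Rightarrow> ('a \<Rightarrow> real) \<Rightarrow> ('a \<Rightarrow> real) \<Rightarrow> ereal" where
  "sup_dist_on D f g = (SUP x\<in>D. ereal \<bar>f x - g x\<bar>)"

end

theory Submission imports Defs begin

text \<open>
  Subtracting an affine function that interpolates \<open>f\<close> along a Hamel basis at a geometrically
  interior point bounds every \<open>\<epsilon>\<close>-affine \<open>f\<close> pointwise by \<open>C x * \<epsilon>\<close>, with \<open>C\<close> independent of
  \<open>f\<close>. If no uniform constant existed, a gliding hump argument would
  build a convergent series of normalized functions whose sum is approximately affine but far from
  every affine function. The hump can be localized on finite sets: by Tychonoff's theorem, being
  within \<open>M\<close> of some affine function on all finite subsets of \<open>D\<close> implies it on \<open>D\<close>.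
\<close>

section \<open>Arithmetic of approximately affine functions\<close>

lemma eps_affine_onD:
  assumes "eps_affine_on \<epsilon> D f" "x \<in> D" "y \<in> D" "0 \<le> t" "t \<le> 1"
  shows "\<bar>f (t *\<^sub>R x + (1 - t) *\<^sub>R y) - t * f x - (1 - t) * f y\<bar> \<le> \<epsilon>"
  using assms unfolding eps_affine_on_def by auto

lemma eps_affine_on_nonneg:
  assumes "eps_affine_on \<epsilon> D f" "x \<in> D"
  shows "0 \<le> \<epsilon>"
  using eps_affine_onD[OF assms(1) assms(2) assms(2), of 0] by simp

lemma eps_affine_on_add:
  assumes "eps_affine_on \<epsilon> D f" "eps_affine_on \<delta> D g"
  shows "eps_affine_on (\<epsilon> + \<delta>) D (\<lambda>x. f x + g x)"
  unfolding eps_affine_on_def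
proof (intro ballI)
  fix x y and t :: real assume H: "x \<in> D" "y \<in> D" "t \<in> {0..1}"
  let ?z = "t *\<^sub>R x + (1 - t) *\<^sub>R y"
  have "f ?z + g ?z - t * (f x + g x) - (1 - t) * (f y + g y)
      = (f ?z - t * f x - (1 - t) * f y) + (g ?z - t * g x - (1 - t) * g y)"
    by (simp add: algebra_simps)
  with eps_affine_onD[OF assms(1), of x y t] eps_affine_onD[OF assms(2), of x y t] H
  show "\<bar>f ?z + g ?z - t * (f x + g x) - (1 - t) * (f y + g y)\<bar> \<le> \<epsilon> + \<delta>"
    by auto
qed

lemma eps_affine_on_cmult:
  assumes "eps_affine_on \<epsilon> D f"
  shows "eps_affine_on (\<bar>c\<bar> * \<epsilon>) D (\<lambda>x. c * f x)"
  unfolding eps_affine_on_def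
proof (intro ballI)
  fix x y and t :: real assume H: "x \<in> D" "y \<in> D" "t \<in> {0..1}"
  let ?z = "t *\<^sub>R x + (1 - t) *\<^sub>R y"
  have "c * f ?z - t * (c * f x) - (1 - t) * (c * f y)
      = c * (f ?z - t * f x - (1 - t) * f y)"
    by (simp add: algebra_simps)
  with eps_affine_onD[OF assms(1), of x y t] H
  show "\<bar>c * f ?z - t * (c * f x) - (1 - t) * (c * f y)\<bar> \<le> \<bar>c\<bar> * \<epsilon>"
    by (simp add: abs_mult mult_left_mono)
qed

lemma eps_affine_on_diff:
  assumes "eps_affine_on \<epsilon> D f" "eps_affine_on \<delta> D g"
  shows "eps_affine_on (\<epsilon> + \<delta>) D (\<lambda>x. f x - g x)"
  using eps_affine_on_add[OF assms(1) eps_affine_on_cmult[OF assms(2), of "-1"]] by simp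

lemma affine_fun_on_diff:
  assumes "affine_fun_on D f" "affine_fun_on D g"
  shows "affine_fun_on D (\<lambda>x. f x - g x)"
  using eps_affine_on_diff[of 0 D f 0 g] assms by (simp add: affine_fun_on_def)

lemma affine_fun_on_add:
  assumes "affine_fun_on D f" "affine_fun_on D g"
  shows "affine_fun_on D (\<lambda>x. f x + g x)"
  using eps_affine_on_add[of 0 D f 0 g] assms by (simp add: affine_fun_on_def)

lemma affine_fun_on_cmult:
  assumes "affine_fun_on D f"
  shows "affine_fun_on D (\<lambda>x. c * f x)"
  using eps_affine_on_cmult[of 0 D f c] assms by (simp add: affine_fun_on_def)

lemma eps_affine_on_diff_affine:
  assumes "eps_affine_on \<epsilon> D f" "affine_fun_on D a"
  shows "eps_affine_on \<epsilon> D (\<lambda>x. f x - a x)"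
  using eps_affine_on_diff[OF assms(1), of 0 a] assms(2) by (simp add: affine_fun_on_def)

lemma affine_fun_on_linear:
  assumes "linear L"
  shows "affine_fun_on D (\<lambda>x. c + L (x - d))"
  unfolding affine_fun_on_def eps_affine_on_def
  by (auto simp: linear_add[OF assms] linear_diff[OF assms] linear_scale[OF assms] algebra_simps)

section \<open>Distance to the affine functions, and its detection on finite sets\<close>

text \<open>Two sets are kept apart: closeness is tested on \<open>F\<close> only, while the
  competitor must be affine on all of \<open>D\<close>. This lets a finite \<open>F\<close> certify
  that \<open>f\<close> is far from the affine functions.\<close>

definition affine_within :: "'a::real_vector set \<Rightarrow> real \<Rightarrow> 'a set \<Rightarrow> ('a \<Rightarrow> real) \<Rightarrow> bool" where
  "affine_within D M F f \<longleftrightarrow> (\<exists>a. affine_fun_on D a \<and> (\<forall>x\<in>F. \<bar>f x - a x\<bar> \<le> M))"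

lemma affine_within_iff_sup_dist:
  "affine_within D M D f \<longleftrightarrow> (\<exists>a. affine_fun_on D a \<and> sup_dist_on D f a \<le> ereal M)"
  by (simp add: affine_within_def sup_dist_on_def SUP_le_iff)

lemma affine_within_of_sup_dist_finite:
  assumes "\<exists>a. affine_fun_on D a \<and> sup_dist_on D f a < \<infinity>"
  shows "\<exists>M. affine_within D M D f"
proof -
  obtain a where a: "affine_fun_on D a" "sup_dist_on D f a < \<infinity>" using assms by blast
  then obtain n :: nat where "sup_dist_on D f a < ereal (real n)"
    using less_PInf_Ex_of_nat by auto
  then show ?thesis using a(1) unfolding affine_within_iff_sup_dist
    by (meson less_imp_le)
qed

lemma affine_within_change:
  assumes "affine_within D M F f" "\<And>x. x \<in> F \<Longrightarrow> \<bar>g x - f x\<bar> \<le> \<delta>"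
  shows "affine_within D (M + \<delta>) F g"
proof -
  obtain a where a: "affine_fun_on D a" "\<And>x. x \<in> F \<Longrightarrow> \<bar>f x - a x\<bar> \<le> M"
    using assms(1) unfolding affine_within_def by blast
  have "\<bar>g x - a x\<bar> \<le> M + \<delta>" if "x \<in> F" for x
    using a(2)[OF that] assms(2)[OF that] by linarith
  then show ?thesis using a(1) unfolding affine_within_def by blast
qed

lemma affine_within_diff:
  assumes "affine_within D M F f" "affine_within D N F g"
  shows "affine_within D (M + N) F (\<lambda>x. f x - g x)"
proof -
  obtain a where a: "affine_fun_on D a" "\<And>x. x \<in> F \<Longrightarrow> \<bar>f x - a x\<bar> \<le> M"
    using assms(1) unfolding affine_within_def by blast
  obtain b where b: "affine_fun_on D b" "\<And>x. x \<in> F \<Longrightarrow> \<bar>g x - b x\<bar> \<le> N"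
    using assms(2) unfolding affine_within_def by blast
  have "\<bar>f x - g x - (a x - b x)\<bar> \<le> M + N" if "x \<in> F" for x
    using a(2)[OF that] b(2)[OF that] by linarith
  then show ?thesis using affine_fun_on_diff[OF a(1) b(1)] unfolding affine_within_def by fast
qed

lemma affine_within_cmult:
  assumes "affine_within D M F f"
  shows "affine_within D (\<bar>c\<bar> * M) F (\<lambda>x. c * f x)"
proof -
  obtain a where a: "affine_fun_on D a" "\<And>x. x \<in> F \<Longrightarrow> \<bar>f x - a x\<bar> \<le> M"
    using assms(1) unfolding affine_within_def by blast
  have "\<bar>c * f x - c * a x\<bar> \<le> \<bar>c\<bar> * M" if "x \<in> F" for x
    using a(2)[OF that] by (metis abs_ge_zero abs_mult mult_left_mono right_diff_distrib)
  then show ?thesis using affine_fun_on_cmult[OF a(1)] unfolding affine_within_def by fast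
qed

lemma affine_within_add_affine:
  assumes "affine_within D M F (\<lambda>x. f x - a x)" "affine_fun_on D a"
  shows "affine_within D M F f"
proof -
  obtain b where b: "affine_fun_on D b" "\<And>x. x \<in> F \<Longrightarrow> \<bar>f x - a x - b x\<bar> \<le> M"
    using assms(1) unfolding affine_within_def by blast
  have "\<bar>f x - (a x + b x)\<bar> \<le> M" if "x \<in> F" for x
    using b(2)[OF that] by (simp add: algebra_simps)
  then show ?thesis using affine_fun_on_add[OF assms(2) b(1)] unfolding affine_within_def by fast
qed

text \<open>A competitor takes its value at \<open>x\<close> in a compact interval around
  \<open>f x\<close>, so the candidates form a compact product. Each instance of the affinity
  equation is a closed condition on at most three coordinates, so finitely many instances involve
  only a finite subset of \<open>D\<close>.\<close>

lemma affine_within_finite_subsets: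
  fixes D :: "'a::real_vector set"
  assumes "convex D" and fin: "\<And>F. finite F \<Longrightarrow> F \<subseteq> D \<Longrightarrow> affine_within D M F f"
  shows "affine_within D M D f"
proof -
  have "0 \<le> M" if "x \<in> D" for x
    using fin[of "{x}"] that unfolding affine_within_def by fastforce
  \<comment> \<open>For empty \<open>D\<close> the number \<open>M\<close> may be negative. The
    radius \<open>\<bar>M\<bar>\<close> keeps every factor nonempty, and it equals \<open>M\<close>
    as soon as \<open>D\<close> has a point.\<close>
  define K where "K = (\<Pi>\<^sub>E x\<in>UNIV. cball (f x) \<bar>M\<bar>)"
  have K: "compact K"
    using compactin_PiE[of "\<lambda>_. euclidean" UNIV "\<lambda>x. cball (f x) \<bar>M\<bar>"]
    unfolding K_def by (simp add: euclidean_product_topology)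
  define T where "T = (\<lambda>(x, y, t). {g :: 'a \<Rightarrow> real.
      g (t *\<^sub>R x + (1 - t) *\<^sub>R y) - t * g x - (1 - t) * g y = 0})"
  define I where "I = D \<times> D \<times> {0..1::real}"
  have Tclosed: "closed (T i)" for i
    unfolding T_def by (cases i)
      (auto intro!: closed_Collect_eq continuous_intros)
  have "K \<inter> (\<Inter>i\<in>I. T i) \<noteq> {}"
  proof (rule compact_imp_fip_image[OF K])
    show "closed (T i)" if "i \<in> I" for i by (rule Tclosed)
  next
    fix J assume J: "finite J" "J \<subseteq> I"
    define F where "F = (\<Union>(x, y, t)\<in>J. {x, y, t *\<^sub>R x + (1 - t) *\<^sub>R y})"
    have "finite F" unfolding F_def using J by auto
    moreover have "F \<subseteq> D"
    proof
      fix z assume "z \<in> F"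
      then obtain x y t where "(x, y, t) \<in> J" and z: "z \<in> {x, y, t *\<^sub>R x + (1 - t) *\<^sub>R y}"
        unfolding F_def by blast
      then have "x \<in> D" "y \<in> D" "0 \<le> t" "t \<le> 1" using J(2) unfolding I_def by auto
      moreover from this have "t *\<^sub>R x + (1 - t) *\<^sub>R y \<in> D"
        using \<open>convex D\<close> by (intro convexD) auto
      ultimately show "z \<in> D" using z by blast
    qed
    ultimately obtain a where a: "affine_fun_on D a" "\<And>x. x \<in> F \<Longrightarrow> \<bar>f x - a x\<bar> \<le> M"
      using fin[of F] unfolding affine_within_def by blast
    \<comment> \<open>Off \<open>F\<close> the function \<open>a\<close> may be far from
      \<open>f\<close> and so leave \<open>K\<close>; there it is replaced by \<open>f\<close>. The
      equations indexed by \<open>J\<close> involve only points of \<open>F\<close>.\<close>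
    define g where "g x = (if x \<in> F then a x else f x)" for x
    have "g \<in> K"
      unfolding K_def using a(2) by (force simp: g_def dist_real_def)
    moreover have "g \<in> T i" if "i \<in> J" for i
    proof -
      obtain x y t where i: "i = (x, y, t)" by (cases i)
      have "{x, y, t *\<^sub>R x + (1 - t) *\<^sub>R y} \<subseteq> F" using that unfolding F_def i by force
      moreover have "a (t *\<^sub>R x + (1 - t) *\<^sub>R y) - t * a x - (1 - t) * a y = 0"
        using eps_affine_onD[OF a(1)[unfolded affine_fun_on_def], of x y t] that J(2)
        unfolding I_def i by auto
      ultimately show ?thesis unfolding T_def i g_def by auto
    qed
    ultimately show "K \<inter> (\<Inter>i\<in>J. T i) \<noteq> {}" by blast
  qed
  then obtain a where a: "a \<in> K" "\<And>i. i \<in> I \<Longrightarrow> a \<in> T i" by blast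
  have "affine_fun_on D a"
    using a(2) unfolding affine_fun_on_def eps_affine_on_def I_def T_def by fastforce
  moreover have "\<bar>f x - a x\<bar> \<le> M" if "x \<in> D" for x
    using a(1) \<open>x \<in> D \<Longrightarrow> 0 \<le> M\<close> that unfolding K_def by (auto simp: dist_real_def PiE_iff)
  ultimately show ?thesis unfolding affine_within_def by blast
qed

section \<open>Sequences with geometrically decaying increments\<close>

text \<open>Serves for pointwise limits: \<open>c\<close> will be the value \<open>C x\<close>,
  which varies with the point.\<close>

lemma bounded_increments_converge:
  fixes u :: "nat \<Rightarrow> real"
  assumes "\<And>n. \<bar>u (Suc n) - u n\<bar> \<le> c * (1/2) ^ n"
  shows "convergent u"
proof -
  have "summable (\<lambda>n. u (Suc n) - u n)"
    by (rule summable_comparison_test'[of "\<lambda>n. c * (1/2) ^ n" 0])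
      (use assms in \<open>auto intro!: summable_mult summable_geometric\<close>)
  then have "(\<lambda>n. \<Sum>i<n. u (Suc i) - u i) \<longlonglongrightarrow> (\<Sum>n. u (Suc n) - u n)"
    by (rule summable_LIMSEQ)
  then have "(\<lambda>n. (u n - u 0) + u 0) \<longlonglongrightarrow> (\<Sum>n. u (Suc n) - u n) + u 0"
    unfolding sum_lessThan_telescope by (intro tendsto_intros)
  then show ?thesis by (auto intro: convergentI)
qed

lemma bounded_increments_bound:
  fixes u :: "nat \<Rightarrow> real"
  assumes "\<And>n. n \<ge> m \<Longrightarrow> \<bar>u (Suc n) - u n\<bar> \<le> (1/2) ^ n" and "n \<ge> m"
  shows "\<bar>u n - u m\<bar> \<le> 2"
proof -
  \<comment> \<open>The sharper bound makes the induction close: passing from \<open>n\<close> to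
    \<open>Suc n\<close> raises it by exactly \<open>(1/2) ^ n\<close>.\<close>
  have "\<bar>u n - u m\<bar> \<le> 2 - 2 * (1/2) ^ n"
    using \<open>n \<ge> m\<close>
  proof (induction n rule: dec_induct)
    case base
    then show ?case by (simp add: power_le_one)
  next
    case (step n)
    then show ?case using assms(1)[of n] by simp
  qed
  then show ?thesis by (smt (verit) zero_le_power divide_nonneg_pos)
qed

section \<open>Pointwise bounds for normalized functions\<close>

text \<open>The vectors \<open>v\<close> with this property form a subspace; \<open>C\<close> does not depend on \<open>g\<close>.\<close>

lemma eps_affine_on_pointwise_bound_span:
  fixes D :: "'a::real_vector set"
  assumes "convex D" and d: "geometrically_interior d D"
    and B: "B \<subseteq> D" and t: "\<And>b. b \<in> B \<Longrightarrow> 0 < t b \<and> d + t b *\<^sub>R b \<in> D"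
    and v: "v \<in> span B"
  shows "\<exists>s>0. \<exists>C\<ge>0. d + s *\<^sub>R v \<in> D \<and> (\<forall>\<epsilon> g. eps_affine_on \<epsilon> D g \<longrightarrow> g d = 0 \<longrightarrow>
           (\<forall>b\<in>B. g (d + t b *\<^sub>R b) = 0) \<longrightarrow> \<bar>g (d + s *\<^sub>R v)\<bar> \<le> C * \<epsilon>)"
proof -
  have dD: "d \<in> D" using d by (simp add: geometrically_interior_def)
  define N where "N \<epsilon> g \<longleftrightarrow> eps_affine_on \<epsilon> D g \<and> g d = 0 \<and> (\<forall>b\<in>B. g (d + t b *\<^sub>R b) = 0)" for \<epsilon> g
  \<comment> \<open>The scale \<open>s\<close> depends on the direction, since \<open>D\<close> may
    extend only a short way from \<open>d\<close> along \<open>v\<close>. Both \<open>s\<close> and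
    \<open>C\<close> are fixed before \<open>g\<close>, which gives the uniformity.\<close>
  define P where "P s C v \<longleftrightarrow> 0 < s \<and> 0 \<le> C \<and> d + s *\<^sub>R v \<in> D \<and>
     (\<forall>\<epsilon> g. N \<epsilon> g \<longrightarrow> \<bar>g (d + s *\<^sub>R v)\<bar> \<le> C * \<epsilon>)" for s C v
  have N0: "0 \<le> \<epsilon>" if "N \<epsilon> g" for \<epsilon> g
    using that eps_affine_on_nonneg dD unfolding N_def by blast
  \<comment> \<open>The nearer point is a convex combination of \<open>d + s *\<^sub>R v\<close> and
    \<open>d\<close>, where \<open>g\<close> vanishes; the affinity defect adds one
    \<epsilon>.\<close>
  have shrink: "P r (C + 1) v" if P: "P s C v" and r: "0 < r" "r \<le> s" for r s C v
  proof -
    have s: "0 < s" using r by simp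
    define k where "k = r / s"
    have eq: "d + r *\<^sub>R v = k *\<^sub>R (d + s *\<^sub>R v) + (1 - k) *\<^sub>R d"
      using s by (simp add: k_def algebra_simps)
    have rs: "0 \<le> k" "k \<le> 1" using r s by (auto simp: k_def)
    have "\<bar>g (d + r *\<^sub>R v)\<bar> \<le> (C + 1) * \<epsilon>" if "N \<epsilon> g" for \<epsilon> g
    proof -
      have g: "\<bar>g (d + s *\<^sub>R v)\<bar> \<le> C * \<epsilon>" using P that unfolding P_def by blast
      have "\<bar>g (d + r *\<^sub>R v) - k * g (d + s *\<^sub>R v) - (1 - k) * g d\<bar> \<le> \<epsilon>"
        unfolding eq using that P dD rs unfolding N_def P_def
        by (intro eps_affine_onD) auto
      moreover have "\<bar>k * g (d + s *\<^sub>R v)\<bar> \<le> \<bar>g (d + s *\<^sub>R v)\<bar>"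
        unfolding abs_mult using rs by (intro mult_left_le_one_le) auto
      moreover have "g d = 0" using that unfolding N_def by blast
      ultimately show ?thesis using g by (simp add: algebra_simps)
    qed
    moreover have "d + r *\<^sub>R v \<in> D"
      unfolding eq using P dD rs \<open>convex D\<close> unfolding P_def by (intro convexD) auto
    ultimately show ?thesis using P r unfolding P_def by auto
  qed
  \<comment> \<open>Here geometric interiority enters: \<open>d\<close> is the midpoint of
    \<open>d + r *\<^sub>R v\<close> and \<open>d - r *\<^sub>R v\<close>. As
    \<open>g d = 0\<close>, reflecting costs twice the defect, whence
    \<open>(C + 1) + 2\<close>.\<close>
  have neg: "\<exists>s C. P s C (- v)" if P: "P s C v" and v: "v \<in> span D" for s C v
  proof -
    obtain \<delta> where \<delta>: "\<delta> > 0" "\<And>r. 0 < r \<Longrightarrow> r < \<delta> \<Longrightarrow> d + r *\<^sub>R v \<in> D \<and> d - r *\<^sub>R v \<in> D"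
      using d v unfolding geometrically_interior_def by blast
    define r where "r = min s (\<delta>/2)"
    have r: "0 < r" "r \<le> s" "r < \<delta>" using \<delta>(1) P unfolding r_def P_def by auto
    have Pr: "P r (C + 1) v" by (rule shrink[OF P r(1,2)])
    have D: "d + r *\<^sub>R v \<in> D" "d - r *\<^sub>R v \<in> D" using \<delta>(2) r by auto
    have eq: "(1/2) *\<^sub>R (d + r *\<^sub>R v) + (1 - 1/2) *\<^sub>R (d - r *\<^sub>R v) = d"
      by (simp add: algebra_simps flip: scaleR_add_left)
    have "\<bar>g (d - r *\<^sub>R v)\<bar> \<le> (C + 3) * \<epsilon>" if "N \<epsilon> g" for \<epsilon> g
    proof -
      have "\<bar>g d - (1/2) * g (d + r *\<^sub>R v) - (1 - 1/2) * g (d - r *\<^sub>R v)\<bar> \<le> \<epsilon>"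
        using eps_affine_onD[of \<epsilon> D g "d + r *\<^sub>R v" "d - r *\<^sub>R v" "1/2"] that D
        unfolding eq N_def by simp
      moreover have "g d = 0" using that unfolding N_def by blast
      moreover have "\<bar>g (d + r *\<^sub>R v)\<bar> \<le> (C + 1) * \<epsilon>" using Pr that unfolding P_def by blast
      ultimately show ?thesis by (simp add: algebra_simps)
    qed
    then have "P r (C + 3) (- v)" using D r Pr unfolding P_def by auto
    then show ?thesis by blast
  qed
  have pos: "\<exists>s C. P s C (c *\<^sub>R v)" if "P s C v" "0 < c" for c s C v
  proof -
    have "P (s / c) C (c *\<^sub>R v)" using that unfolding P_def by auto
    then show ?thesis by blast
  qed
  have zero: "P 1 0 0" using dD unfolding P_def N_def by auto
  \<comment> \<open>Membership in \<open>span D\<close> is recorded because \<open>neg\<close> needs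
    it to move from \<open>d\<close> in both directions.\<close>
  define S where "S = {v \<in> span D. \<exists>s C. P s C v}"
  have "subspace S"
    unfolding subspace_def
  proof (intro conjI ballI allI)
    show "0 \<in> S" using zero span_zero unfolding S_def by blast
  next
    fix v w assume "v \<in> S" "w \<in> S"
    then obtain s C s' C' where P: "P s C v" "P s' C' w" and sp: "v + w \<in> span D"
      unfolding S_def using span_add by blast
    \<comment> \<open>At a common scale \<open>r\<close> for both vectors, the point
      \<open>d + (r/2) *\<^sub>R (v + w)\<close> is the midpoint of two points already under
      control.\<close>
    define r where "r = min s s'"
    have r: "r > 0" "r \<le> s" "r \<le> s'" using P unfolding r_def P_def by auto
    have P': "P r (C + 1) v" "P r (C' + 1) w" using shrink P r by blast+
    have eq: "d + (r/2) *\<^sub>R (v + w) = (1/2) *\<^sub>R (d + r *\<^sub>R v) + (1 - 1/2) *\<^sub>R (d + r *\<^sub>R w)"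
      by (simp add: algebra_simps flip: scaleR_add_left)
    have "\<bar>g (d + (r/2) *\<^sub>R (v + w))\<bar> \<le> (C + C' + 3) * \<epsilon>" if "N \<epsilon> g" for \<epsilon> g
    proof -
      have "\<bar>g (d + (r/2) *\<^sub>R (v + w)) - (1/2) * g (d + r *\<^sub>R v) - (1 - 1/2) * g (d + r *\<^sub>R w)\<bar> \<le> \<epsilon>"
        unfolding eq using that P' unfolding N_def P_def by (intro eps_affine_onD) auto
      moreover have "\<bar>g (d + r *\<^sub>R v)\<bar> \<le> (C + 1) * \<epsilon>" "\<bar>g (d + r *\<^sub>R w)\<bar> \<le> (C' + 1) * \<epsilon>"
        using P' that unfolding P_def by blast+
      ultimately show ?thesis by (simp add: algebra_simps)
    qed
    moreover have "d + (r/2) *\<^sub>R (v + w) \<in> D"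
      unfolding eq using P' \<open>convex D\<close> unfolding P_def by (intro convexD) auto
    ultimately have "P (r/2) (C + C' + 3) (v + w)" using r P unfolding P_def by auto
    then show "v + w \<in> S" using sp unfolding S_def by blast
  next
    fix c v assume "v \<in> S"
    then obtain s C where P: "P s C v" and sp: "v \<in> span D" unfolding S_def by blast
    have "\<exists>s C. P s C (c *\<^sub>R v)"
    proof (cases c "0::real" rule: linorder_cases)
      case less
      obtain s' C' where "P s' C' (- v)" using neg P sp by blast
      then show ?thesis using pos[of s' C' "- v" "- c"] less by simp
    next
      case equal
      then show ?thesis using zero by auto
    next
      case greater
      then show ?thesis using pos P by blast
    qed
    then show "c *\<^sub>R v \<in> S" using sp span_scale unfolding S_def by blast
  qed
  moreover have "B \<subseteq> S"
  proof
    fix b assume b: "b \<in> B"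
    have "P (t b) 0 b" using t[OF b] b unfolding P_def N_def by auto
    then show "b \<in> S" using b B span_base unfolding S_def by blast
  qed
  ultimately have "v \<in> S" using v span_minimal by blast
  then show ?thesis unfolding S_def P_def N_def by blast
qed

text \<open>An affine function matching \<open>f\<close> at \<open>d\<close> and slightly away from
  \<open>d\<close> in each direction of a Hamel basis leaves a normalized difference, and every
  \<open>x - d\<close> lies in the span of that basis. The function \<open>C\<close> depends on
  \<open>D\<close> alone but may be unbounded.\<close>

lemma eps_affine_on_pointwise_bound:
  fixes D :: "'a::real_vector set"
  assumes "thick D"
  shows "\<exists>C. (\<forall>x\<in>D. 0 \<le> C x) \<and> (\<forall>\<epsilon> f. eps_affine_on \<epsilon> D f \<longrightarrow>
           (\<exists>a. affine_fun_on D a \<and> (\<forall>x\<in>D. \<bar>f x - a x\<bar> \<le> C x * \<epsilon>)))"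
proof -
  obtain d where "convex D" and d: "geometrically_interior d D"
    using assms unfolding thick_def by blast
  have dD: "d \<in> D" using d by (simp add: geometrically_interior_def)
  obtain B where B: "B \<subseteq> D" "independent B" "D \<subseteq> span B"
    using maximal_independent_subset[of D] by blast
  have "\<exists>t. 0 < t \<and> d + t *\<^sub>R b \<in> D" if "b \<in> B" for b
  proof -
    have "b \<in> span D" using that B(1) by (simp add: span_base subset_iff)
    then obtain \<delta> where "\<delta> > 0" "\<And>t. 0 < t \<Longrightarrow> t < \<delta> \<Longrightarrow> d + t *\<^sub>R b \<in> D"
      using d unfolding geometrically_interior_def by blast
    then have "0 < \<delta> / 2 \<and> d + (\<delta> / 2) *\<^sub>R b \<in> D" by simp
    then show ?thesis by blast
  qed
  then obtain t where t: "\<And>b. b \<in> B \<Longrightarrow> 0 < t b \<and> d + t b *\<^sub>R b \<in> D" by metis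
  define N where "N \<epsilon> g \<longleftrightarrow> eps_affine_on \<epsilon> D g \<and> g d = 0 \<and> (\<forall>b\<in>B. g (d + t b *\<^sub>R b) = 0)" for \<epsilon> g
  have "\<exists>C\<ge>0. \<forall>\<epsilon> g. N \<epsilon> g \<longrightarrow> \<bar>g x\<bar> \<le> C * \<epsilon>" if x: "x \<in> D" for x
  proof -
    have "x - d \<in> span B" using x dD B(3) by (meson span_diff subsetD)
    from eps_affine_on_pointwise_bound_span[OF \<open>convex D\<close> d B(1) t this]
    obtain s C where s: "s > 0" "C \<ge> 0" "d + s *\<^sub>R (x - d) \<in> D"
      and C: "\<And>\<epsilon> g. N \<epsilon> g \<Longrightarrow> \<bar>g (d + s *\<^sub>R (x - d))\<bar> \<le> C * \<epsilon>"
      unfolding N_def by blast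
    \<comment> \<open>The bound holds at \<open>d + s *\<^sub>R (x - d)\<close> and must be carried
      over to \<open>x\<close>. If \<open>s \<le> 1\<close>, that point lies between
      \<open>d\<close> and \<open>x\<close>, and one solves for \<open>g x\<close>, dividing by
      \<open>s\<close>. Otherwise \<open>x\<close> lies between \<open>d\<close> and that
      point.\<close>
    show ?thesis
    proof (cases "s \<le> 1")
      case True
      have eq: "d + s *\<^sub>R (x - d) = s *\<^sub>R x + (1 - s) *\<^sub>R d" by (simp add: algebra_simps)
      have "\<bar>g x\<bar> \<le> ((C + 1) / s) * \<epsilon>" if "N \<epsilon> g" for \<epsilon> g
      proof -
        have "\<bar>g (d + s *\<^sub>R (x - d)) - s * g x - (1 - s) * g d\<bar> \<le> \<epsilon>"
          unfolding eq using that x dD s True unfolding N_def by (intro eps_affine_onD) auto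
        moreover have "g d = 0" using that unfolding N_def by blast
        ultimately have "\<bar>s * g x\<bar> \<le> (C + 1) * \<epsilon>"
          using C[OF that] by (simp add: algebra_simps)
        then have "s * \<bar>g x\<bar> \<le> (C + 1) * \<epsilon>" using s by (simp add: abs_mult)
        then show ?thesis using s by (simp add: field_simps)
      qed
      moreover have "(C + 1) / s \<ge> 0" using s by simp
      ultimately show ?thesis by blast
    next
      case False
      define r where "r = 1 / s"
      have r: "0 \<le> r" "r \<le> 1" using s False unfolding r_def by auto
      have eq: "x = r *\<^sub>R (d + s *\<^sub>R (x - d)) + (1 - r) *\<^sub>R d"
        using s unfolding r_def by (simp add: algebra_simps)
      have "\<bar>g x\<bar> \<le> (C + 1) * \<epsilon>" if "N \<epsilon> g" for \<epsilon> g
      proof -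
        have "\<bar>g (r *\<^sub>R (d + s *\<^sub>R (x - d)) + (1 - r) *\<^sub>R d) - r * g (d + s *\<^sub>R (x - d)) - (1 - r) * g d\<bar> \<le> \<epsilon>"
          using that dD s r unfolding N_def by (intro eps_affine_onD) auto
        moreover have "g d = 0" using that unfolding N_def by blast
        moreover have "\<bar>r * g (d + s *\<^sub>R (x - d))\<bar> \<le> \<bar>g (d + s *\<^sub>R (x - d))\<bar>"
          unfolding abs_mult using r by (intro mult_left_le_one_le) auto
        ultimately show ?thesis
          using C[OF that] unfolding eq[symmetric] by (simp add: algebra_simps)
      qed
      moreover have "C + 1 \<ge> 0" using s by simp
      ultimately show ?thesis by blast
    qed
  qed
  then obtain C where C: "\<And>x. x \<in> D \<Longrightarrow> 0 \<le> C x" "\<And>x \<epsilon> g. x \<in> D \<Longrightarrow> N \<epsilon> g \<Longrightarrow> \<bar>g x\<bar> \<le> C x * \<epsilon>"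
    by metis
  have "\<exists>a. affine_fun_on D a \<and> (\<forall>x\<in>D. \<bar>f x - a x\<bar> \<le> C x * \<epsilon>)" if f: "eps_affine_on \<epsilon> D f" for \<epsilon> f
  proof -
    \<comment> \<open>The prescribed slopes are the difference quotients of \<open>f\<close> at
      \<open>d\<close>, so that \<open>a\<close> agrees with \<open>f\<close> at every
      \<open>d + t b *\<^sub>R b\<close>.\<close>
    obtain L where L: "linear L" "\<And>b. b \<in> B \<Longrightarrow> L b = (f (d + t b *\<^sub>R b) - f d) / t b"
      using linear_independent_extend[OF B(2), of "\<lambda>b. (f (d + t b *\<^sub>R b) - f d) / t b"] by blast
    define a where "a x = f d + L (x - d)" for x
    have a: "affine_fun_on D a" unfolding a_def by (rule affine_fun_on_linear[OF L(1)])
    have "a d = f d" unfolding a_def by (simp add: linear_0[OF L(1)])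
    moreover have "a (d + t b *\<^sub>R b) = f (d + t b *\<^sub>R b)" if "b \<in> B" for b
      using t[OF that] L(2)[OF that] unfolding a_def by (simp add: linear_scale[OF L(1)])
    ultimately have "N \<epsilon> (\<lambda>x. f x - a x)"
      unfolding N_def using eps_affine_on_diff_affine[OF f a] by simp
    then show ?thesis using C(2) a by blast
  qed
  then show ?thesis using C(1) by blast
qed

section \<open>The gliding hump\<close>

lemma affine_within_uniform:
  fixes D :: "'a::real_vector set"
  assumes "convex D"
    and hyp: "\<And>f. approximately_affine_on D f \<Longrightarrow> \<exists>M. affine_within D M D f"
    and C: "\<And>x. x \<in> D \<Longrightarrow> 0 \<le> C x"
  shows "\<exists>M. \<forall>g. eps_affine_on 1 D g \<longrightarrow> (\<forall>x\<in>D. \<bar>g x\<bar> \<le> C x) \<longrightarrow> affine_within D M D g"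
proof (rule ccontr)
  assume "\<not> ?thesis"
  then have unb: "\<exists>g. eps_affine_on 1 D g \<and> (\<forall>x\<in>D. \<bar>g x\<bar> \<le> C x) \<and> \<not> affine_within D M D g" for M
    by blast
  \<comment> \<open>A stage is a partial sum \<open>G\<close> with a finite set \<open>K\<close>
    certifying that \<open>G\<close> is not within \<open>n\<close> of any affine function.\<close>
  define P where "P n = (\<lambda>(G, K). approximately_affine_on D G \<and> finite K \<and> K \<subseteq> D
      \<and> \<not> affine_within D (real n) K G)" for n
  \<comment> \<open>The decaying defects make the limit approximately affine, the bound by
    \<open>C x\<close> gives pointwise convergence, and the bound on \<open>K\<close> preserves the
    certificate in the limit.\<close>
  define R where "R n = (\<lambda>(G :: 'a \<Rightarrow> real, K) (G', K'). K \<subseteq> K' \<and>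
      eps_affine_on ((1/2)^n) D (\<lambda>x. G' x - G x) \<and> (\<forall>x\<in>D. \<bar>G' x - G x\<bar> \<le> C x * (1/2)^n) \<and>
      (\<forall>x\<in>K. \<bar>G' x - G x\<bar> \<le> (1/2)^n))" for n :: nat
  have step: "\<exists>q. P m q \<and> R n (G, K) q"
    if G: "approximately_affine_on D G" "finite K" "K \<subseteq> D" for m n G K
  proof -
    obtain M where M: "affine_within D M D G" using hyp[OF G(1)] by blast
    \<comment> \<open>The weight \<open>c\<close> is so small that adding \<open>c * g\<close> cannot destroy the earlier humps on \<open>K\<close>.\<close>
    define S where "S = 1 + (\<Sum>x\<in>K. C x)"
    have S: "1 \<le> S" unfolding S_def using C G(3) by (simp add: sum_nonneg subset_iff)
    define c where "c = (1/2)^n / S"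
    have c: "0 < c" "c \<le> (1/2)^n" "c * S = (1/2)^n"
      unfolding c_def using S by (auto simp: field_simps)
    \<comment> \<open>If \<open>G + c * g\<close> were within \<open>m\<close> of an affine
      function, then subtracting \<open>G\<close>, which is within \<open>M\<close> of one, and
      dividing by \<open>c\<close> would put \<open>g\<close> within
      \<open>(m + M) / c\<close>.\<close>
    obtain g where g: "eps_affine_on 1 D g" "\<And>x. x \<in> D \<Longrightarrow> \<bar>g x\<bar> \<le> C x"
      and ng: "\<not> affine_within D (\<bar>1/c\<bar> * (real m + M)) D g"
      using unb by blast
    define G' where "G' x = G x + c * g x" for x
    have "\<not> affine_within D (real m) D G'"
    proof
      assume "affine_within D (real m) D G'"
      from affine_within_cmult[OF affine_within_diff[OF this M], of "1/c"] ng c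
      show False unfolding G'_def by simp
    qed
    \<comment> \<open>Compactness turns failure on \<open>D\<close> into failure on a finite set.
      Joining it to \<open>K\<close> keeps the certificates nested.\<close>
    then obtain F where F: "finite F" "F \<subseteq> D" "\<not> affine_within D (real m) F G'"
      using affine_within_finite_subsets[OF \<open>convex D\<close>] by blast
    have cg: "eps_affine_on c D (\<lambda>x. c * g x)"
      using eps_affine_on_cmult[OF g(1), of c] c by simp
    have "approximately_affine_on D G'"
      using G(1) eps_affine_on_add[OF _ cg] unfolding approximately_affine_on_def G'_def by blast
    moreover have "\<not> affine_within D (real m) (K \<union> F) G'"
      using F(3) unfolding affine_within_def by blast
    ultimately have 1: "P m (G', K \<union> F)" using F G unfolding P_def by simp
    have "eps_affine_on ((1/2)^n) D (\<lambda>x. c * g x)"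
      using cg c(2) unfolding eps_affine_on_def by (meson order_trans)
    moreover have "\<bar>c * g x\<bar> \<le> C x * (1/2)^n" if "x \<in> D" for x
    proof -
      have "\<bar>c * g x\<bar> = c * \<bar>g x\<bar>" using c by (simp add: abs_mult)
      also have "\<dots> \<le> (1/2)^n * C x" using c g(2)[OF that] by (intro mult_mono) auto
      finally show ?thesis by (simp add: mult.commute)
    qed
    moreover have "\<bar>c * g x\<bar> \<le> (1/2)^n" if "x \<in> K" for x
    proof -
      have "\<bar>g x\<bar> \<le> C x" using g(2) that G(3) by blast
      also have "\<dots> \<le> (\<Sum>x\<in>K. C x)" using that G C by (intro member_le_sum) auto
      finally have "c * \<bar>g x\<bar> \<le> c * S" using c unfolding S_def by (intro mult_left_mono) auto
      then show ?thesis using c by (simp add: abs_mult)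
    qed
    ultimately have "R n (G, K) (G', K \<union> F)" unfolding R_def G'_def by simp
    with 1 show ?thesis by blast
  qed
  have "approximately_affine_on D (\<lambda>_. 0)"
    unfolding approximately_affine_on_def eps_affine_on_def by auto
  \<comment> \<open>Stage 0 already demands a \<open>G\<close> that is not affine, so it comes from
    one step applied to the zero function.\<close>
  then have P0: "\<exists>q. P 0 q" using step[of "\<lambda>_. 0" "{}" 0] by blast
  have PS: "\<exists>q'. P (Suc n) q' \<and> R n q q'" if "P n q" for n q
    using step[of "fst q" "snd q" "Suc n" n] that unfolding P_def by (auto simp: split_beta)
  obtain q where q: "\<And>n. P n (q n)" "\<And>n. R n (q n) (q (Suc n))"
    using dependent_nat_choice[of P R, OF P0 PS] by blast
  define G K where "G n = fst (q n)" and "K n = snd (q n)" for n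
  have KD: "K n \<subseteq> D" and nG: "\<not> affine_within D (real n) (K n) (G n)"
    and G0: "approximately_affine_on D (G n)" for n
    using q(1)[of n] unfolding P_def G_def K_def by (auto simp: split_beta)
  have KS: "K n \<subseteq> K (Suc n)"
    and Ga: "eps_affine_on ((1/2)^n) D (\<lambda>x. G (Suc n) x - G n x)"
    and GC: "\<And>x. x \<in> D \<Longrightarrow> \<bar>G (Suc n) x - G n x\<bar> \<le> C x * (1/2)^n"
    and GK: "\<And>x. x \<in> K n \<Longrightarrow> \<bar>G (Suc n) x - G n x\<bar> \<le> (1/2)^n" for n
    using q(2)[of n] unfolding R_def G_def K_def by (auto simp: split_beta)
  define f where "f x = lim (\<lambda>n. G n x)" for x
  have lim: "(\<lambda>n. G n x) \<longlonglongrightarrow> f x" if "x \<in> D" for x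
    unfolding f_def using bounded_increments_converge[OF GC[OF that]] by (simp add: convergent_LIMSEQ_iff)
  obtain \<epsilon>0 where \<epsilon>0: "eps_affine_on \<epsilon>0 D (G 0)"
    using G0 unfolding approximately_affine_on_def by blast
  have "eps_affine_on (\<epsilon>0 + 2) D f"
    unfolding eps_affine_on_def
  proof (intro ballI)
    fix x y and t :: real assume H: "x \<in> D" "y \<in> D" "t \<in> {0..1}"
    define z where "z = t *\<^sub>R x + (1 - t) *\<^sub>R y"
    have z: "z \<in> D" unfolding z_def using H \<open>convex D\<close> by (auto intro: convexD)
    \<comment> \<open>\<open>u n\<close> is the affinity defect of \<open>G n\<close> at the given
      points, and its increments are defects of \<open>G (Suc n) - G n\<close>. They sum to at most
      2, so the limit has defect at most \<open>\<epsilon>0 + 2\<close>.\<close>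
    define u where "u n = G n z - t * G n x - (1 - t) * G n y" for n
    have "\<bar>u (Suc n) - u n\<bar> \<le> (1/2)^n" for n
      using eps_affine_onD[OF Ga[of n] H(1,2), of t] H(3) unfolding u_def z_def
      by (simp add: algebra_simps)
    then have u: "\<bar>u n - u 0\<bar> \<le> 2" for n by (intro bounded_increments_bound) auto
    have "\<bar>u 0\<bar> \<le> \<epsilon>0"
      using eps_affine_onD[OF \<epsilon>0 H(1,2), of t] H(3) unfolding u_def z_def by simp
    then have "\<bar>u n\<bar> \<le> \<epsilon>0 + 2" for n using u[of n] by linarith
    moreover have "(\<lambda>n. \<bar>u n\<bar>) \<longlonglongrightarrow> \<bar>f z - t * f x - (1 - t) * f y\<bar>"
      unfolding u_def by (intro tendsto_intros lim H z)
    ultimately show "\<bar>f (t *\<^sub>R x + (1 - t) *\<^sub>R y) - t * f x - (1 - t) * f y\<bar> \<le> \<epsilon>0 + 2"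
      unfolding z_def[symmetric] by (intro LIMSEQ_le_const2) auto
  qed
  then obtain M where M: "affine_within D M D f"
    using hyp unfolding approximately_affine_on_def by blast
  \<comment> \<open>On \<open>K n\<close> all later increments are small because the sets are
    nested, so \<open>f\<close> and \<open>G n\<close> differ there by at most 2. Closeness
    \<open>M\<close> for \<open>f\<close> would then give closeness \<open>M + 2 \<le> n\<close> for
    \<open>G n\<close>, against its certificate.\<close>
  obtain n :: nat where n: "M + 2 \<le> real n" using real_arch_simple by blast
  have "\<bar>G n x - f x\<bar> \<le> 2" if x: "x \<in> K n" for x
  proof -
    have "x \<in> K m" if "m \<ge> n" for m
      using that x KS by (meson lift_Suc_mono_le subsetD)
    then have "\<bar>G m x - G n x\<bar> \<le> 2" if "m \<ge> n" for m
      using that GK by (intro bounded_increments_bound[of n "\<lambda>n. G n x" m]) auto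
    moreover have "(\<lambda>m. \<bar>G m x - G n x\<bar>) \<longlonglongrightarrow> \<bar>f x - G n x\<bar>"
      using x KD by (intro tendsto_intros lim) auto
    ultimately have "\<bar>f x - G n x\<bar> \<le> 2" by (intro LIMSEQ_le_const2) auto
    then show ?thesis by linarith
  qed
  moreover have "affine_within D M (K n) f" using M KD unfolding affine_within_def by blast
  ultimately have "affine_within D (M + 2) (K n) (G n)" by (intro affine_within_change) auto
  then show False using nG n unfolding affine_within_def by fastforce
qed

section \<open>Rescaling to arbitrary \<epsilon>\<close>

theorem theorem4:
  fixes D :: "'a::real_vector set"
  assumes "convex D" and "thick D"
    and "\<And>f :: 'a \<Rightarrow> real. approximately_affine_on D f \<Longrightarrow>
           \<exists>a. affine_fun_on D a \<and> sup_dist_on D f a < \<infinity>"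
  shows "\<exists>A::real. \<forall>\<epsilon>::real. \<forall>f :: 'a \<Rightarrow> real. eps_affine_on \<epsilon> D f \<longrightarrow>
           (\<exists>a. affine_fun_on D a \<and> sup_dist_on D f a \<le> ereal (A * \<epsilon>))"
proof -
  obtain d where d: "d \<in> D"
    using assms(2) unfolding thick_def geometrically_interior_def by blast
  obtain C where C: "\<And>x. x \<in> D \<Longrightarrow> 0 \<le> C x"
    "\<And>\<epsilon> f. eps_affine_on \<epsilon> D f \<Longrightarrow> \<exists>a. affine_fun_on D a \<and> (\<forall>x\<in>D. \<bar>f x - a x\<bar> \<le> C x * \<epsilon>)"
    using eps_affine_on_pointwise_bound[OF assms(2)] by blast
  obtain A where A: "\<And>g. eps_affine_on 1 D g \<Longrightarrow> (\<forall>x\<in>D. \<bar>g x\<bar> \<le> C x) \<Longrightarrow> affine_within D A D g"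
    using affine_within_uniform[where C = C, OF assms(1) _ C(1)]
      affine_within_of_sup_dist_finite assms(3) by blast
  have "affine_within D (A * \<epsilon>) D f" if f: "eps_affine_on \<epsilon> D f" for \<epsilon> f
  proof (cases "\<epsilon> = 0")
    case True
    then show ?thesis using f unfolding affine_within_def affine_fun_on_def by force
  next
    case False
    then have \<epsilon>: "\<epsilon> > 0" using eps_affine_on_nonneg[OF f d] by simp
    obtain a where a: "affine_fun_on D a" "\<And>x. x \<in> D \<Longrightarrow> \<bar>f x - a x\<bar> \<le> C x * \<epsilon>"
      using C(2)[OF f] by blast
    \<comment> \<open>Dividing by \<epsilon> brings the difference into the class of 1-affine
      functions dominated by \<open>C\<close>, where \<open>A\<close> works. The case of zero
      \<epsilon> is separate: there \<open>f\<close> itself is affine.\<close>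
    define g where "g x = (1/\<epsilon>) * (f x - a x)" for x
    have "eps_affine_on 1 D g"
      using eps_affine_on_cmult[OF eps_affine_on_diff_affine[OF f a(1)], of "1/\<epsilon>"] \<epsilon>
      unfolding g_def by simp
    moreover have "\<forall>x\<in>D. \<bar>g x\<bar> \<le> C x"
      using a(2) \<epsilon> unfolding g_def by (auto simp: abs_mult field_simps)
    ultimately have "affine_within D A D g" by (rule A)
    from affine_within_cmult[OF this, of \<epsilon>] \<epsilon>
    have "affine_within D (A * \<epsilon>) D (\<lambda>x. f x - a x)"
      unfolding g_def by (simp add: mult.commute)
    then show ?thesis using a(1) by (rule affine_within_add_affine)
  qed
  then show ?thesis unfolding affine_within_iff_sup_dist by blast
qed

end
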